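(* Let $T_0$ be a finite set of primitive tests, $\mathcal A_0$ a finite set of primitive choices, $\mathcal T$ a consistent theory, and $C\subseteq \mathcal A_{\mathcal A_0,T_0}$. A preference relation $\succeq$ on $C$ has a constructive $\mathcal T$-consistent SEU representation if and only if $\succeq$ satisfies $\mathbf{A2'}$. Moreover, when $\succeq$ satisfies $\mathbf{A2'}$: in the representation, either $\mathcal P$ or $\mathcal U$ can be taken to be a singleton (i.e. there is a representation with $\mathcal P$ a singleton, and there is one with $\mathcal U$ a singleton); if $\mathcal U$ is a singleton $\{u\}$, the state space can be taken to be $\mathrm{At}_{\mathcal T}(T_0)\times EX_{\mathrm{AX}}(\succeq)$. If, in addition, $\succeq$ satisfies $\mathbf{A1}$ (completeness: for all $a,b\in C$, $a\succeq b$ or $b\succeq a$), then $\mathcal V$ can be taken to be a singleton (so both $\mathcal P$ and $\mathcal U$ can be taken to be singletons).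
   Context: **Tests.** $T$ is the smallest set containing the finite set $T_0$ of primitive tests and closed under $\wedge$ and $\neg$ (a propositional language). A theory is a set $\mathcal T\subseteq T$. **Choices.** $\mathcal A_{\mathcal A_0,T_0}$ is the smallest set of syntactic expressions containing the finite nonempty set $\mathcal A_0$ such that if $t\in T$ and $a,b$ are in the set, so is "$\mathbf{if}\ t\ \mathbf{then}\ a\ \mathbf{else}\ b$". **Preference relation** on $C$: an arbitrary binary relation $\succeq$ on $C$ (not assumed complete or transitive). **Interpretations.** A (standard) test interpretation for a set $S$ is a map $\pi_S:T\to 2^S$ with $\pi_S(t_1\wedge t_2)=\pi_S(t_1)\cap\pi_S(t_2)$ and $\pi_S(\neg t)=S\setminus\pi_S(t)$. All test interpretations here are standard. It respects (is consistent with) $\mathcal T$ if $\pi_S(t)=S$ for all $t\in\mathcal T$. Given $\pi_S$ and a map $\rho^0_{SO}:\mathcal A_0\to O^S$, the choice interpretation $\rho_{SO}:\mathcal A_{\mathcal A_0,T_0}\to O^S$ compatible with $\pi_S$ extends $\rho^0_{SO}$ by $\rho_{SO}(\mathbf{if}\ t\ \mathbf{then}\ a_1\ \mathbf{else}\ a_2)(s)=\rho_{SO}(a_1)(s)$ if $s\in\pi_S(t)$ and $=\rho_{SO}(a_2)(s)$ otherwise. **Atoms.** If $T_0=\{t_1,\dots,t_n\}$, an atom is a test $t_1'\wedge\dots\wedge t_n'$ with each $t_i'\in\{t_i,\neg t_i\}$. For an atom $\delta$ and test $t$, write $\delta\Rightarrow t$ if $\pi_S(\delta)\subseteq\pi_S(t)$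 for all $S$ and standard $\pi_S$ (propositional entailment). $\mathrm{At}_{\mathcal T}(T_0)$ is the set of atoms $\delta$ consistent with $\mathcal T$, i.e. $\pi_S(\delta)\neq\emptyset$ for some $S$ and some standard $\pi_S$ respecting $\mathcal T$. $\mathcal T$ is consistent if $\mathrm{At}_{\mathcal T}(T_0)\ne\emptyset$. **The functions $f_a$** from atoms to $\mathcal A_0$: $f_a$ is the constant $a$ for $a\in\mathcal A_0$, and $f_{\mathbf{if}\ t\ \mathbf{then}\ a\ \mathbf{else}\ b}(\delta)=f_a(\delta)$ if $\delta\Rightarrow t$, and $=f_b(\delta)$ otherwise. **Axiom $\mathbf{A2'}$.** If $\langle a_1,\dots,a_n\rangle$, $\langle b_1,\dots,b_n\rangle$ ($n\ge1$) are sequences of elements of $C$ such that for each $\delta\in\mathrm{At}_{\mathcal T}(T_0)$ the multisets $\{\{f_{a_1}(\delta),\dots,f_{a_n}(\delta)\}\}$ and $\{\{f_{b_1}(\delta),\dots,f_{b_n}(\delta)\}\}$ are equal, and there is $0\le k<n$ with $a_i\succeq b_i$ for all $i\le k$, $a_{k+1}=\dots=a_n$ and $b_{k+1}=\dots=b_n$, then $b_n\succeq a_n$. **Axiom $\mathbf{A2}$** is the special case $k=n-1$. **$EX_{\mathrm{AX}}(\succeq)$** is the set of all complete binary relations on $C$ that contain $\succeq$ and satisfy $\mathbf{A2}$. **Representation.** $\succeq$ on $C$ has a constructive $\mathcal T$-consistent SEU representation iff there are a finite set $S$ of states, a finite set $O$ of outcomes, a set $\mathcal U$ of utility functions $u:O\to\mathbb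 R$, a set $\mathcal P$ of probability distributions on $S$, a subset $\mathcal V\subseteq\mathcal U\times\mathcal P$, a test interpretation $\pi_S$ respecting $\mathcal T$, and a choice interpretation $\rho_{SO}$ compatible with $\pi_S$, such that for all $a,b\in C$: $a\succeq b$ iff $\sum_{s\in S}u(\rho_{SO}(a)(s))p(s)\ge\sum_{s\in S}u(\rho_{SO}(b)(s))p(s)$ for all $(u,p)\in\mathcal V$. *)

theory Defs
  imports "HOL-Library.Multiset" "HOL-Probability.Probability"
begin

datatype 'p test = Prim 'p | And "'p test" "'p test" | Neg "'p test"

inductive_set tests :: "'p set \<Rightarrow> 'p test set" for T0 where
  prim: "p \<in> T0 \<Longrightarrow> Prim p \<in> tests T0"
| conj: "t \<in> tests T0 \<Longrightarrow> t' \<in> tests T0 \<Longrightarrow> And t t' \<in> tests T0"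
| neg: "t \<in> tests T0 \<Longrightarrow> Neg t \<in> tests T0"

datatype ('p, 'a) choice = Act 'a | Ite "'p test" "('p, 'a) choice" "('p, 'a) choice"

inductive_set choices :: "'a set \<Rightarrow> 'p set \<Rightarrow> ('p, 'a) choice set" for A0 T0 where
  act: "a \<in> A0 \<Longrightarrow> Act a \<in> choices A0 T0"
| ite: "t \<in> tests T0 \<Longrightarrow> a \<in> choices A0 T0 \<Longrightarrow> b \<in> choices A0 T0
        \<Longrightarrow> Ite t a b \<in> choices A0 T0"

text \<open>Only the values of an interpretation on the tests over \<open>T0\<close> matter.\<close>

definition test_interp :: "'p set \<Rightarrow> 's set \<Rightarrow> ('p test \<Rightarrow> 's set) \<Rightarrow> bool" where
  "test_interp T0 S \<pi> \<longleftrightarrow>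
     (\<forall>t\<in>tests T0. \<pi> t \<subseteq> S) \<and>
     (\<forall>t\<in>tests T0. \<forall>t'\<in>tests T0. \<pi> (And t t') = \<pi> t \<inter> \<pi> t') \<and>
     (\<forall>t\<in>tests T0. \<pi> (Neg t) = S - \<pi> t)"

definition respects_theory :: "'p test set \<Rightarrow> 's set \<Rightarrow> ('p test \<Rightarrow> 's set) \<Rightarrow> bool" where
  "respects_theory Th S \<pi> \<longleftrightarrow> (\<forall>t\<in>Th. \<pi> t = S)"

text \<open>The choice interpretation that extends \<open>\<rho>\<close> and is compatible with \<open>\<pi>\<close>.\<close>

primrec choice_interp ::
    "('p test \<Rightarrow> 's set) \<Rightarrow> ('a \<Rightarrow> 's \<Rightarrow> 'o) \<Rightarrow> ('p, 'a) choice \<Rightarrow> 's \<Rightarrow> 'o" where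
  "choice_interp \<pi> \<rho> (Act a) = \<rho> a"
| "choice_interp \<pi> \<rho> (Ite t a b) =
     (\<lambda>s. if s \<in> \<pi> t then choice_interp \<pi> \<rho> a s else choice_interp \<pi> \<rho> b s)"

text \<open>Atoms are tests, formed along an enumeration of the primitive tests. An empty conjunction
  is not a test, so there are no atoms (and hence no consistent theory) without primitive tests.\<close>

fun atoms :: "'p list \<Rightarrow> 'p test set" where
  "atoms [] = {}"
| "atoms [p] = {Prim p, Neg (Prim p)}"
| "atoms (p # q # ps) = {And l d | l d. l \<in> {Prim p, Neg (Prim p)} \<and> d \<in> atoms (q # ps)}"

text \<open>HOL cannot quantify over the type of states inside a formula. The next two definitions use
  sets of natural numbers; \<open>entails_any_states\<close> and \<open>consistent_atoms_any_states\<close> below show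
  that this covers state spaces of every type, infinite ones included.\<close>

definition entails :: "'p set \<Rightarrow> 'p test \<Rightarrow> 'p test \<Rightarrow> bool" where
  "entails T0 d t \<longleftrightarrow> (\<forall>(S::nat set) \<pi>. test_interp T0 S \<pi> \<longrightarrow> \<pi> d \<subseteq> \<pi> t)"

definition consistent_atoms :: "'p list \<Rightarrow> 'p test set \<Rightarrow> 'p test set" where
  "consistent_atoms ts Th =
     {d \<in> atoms ts. \<exists>(S::nat set) \<pi>. test_interp (set ts) S \<pi> \<and> respects_theory Th S \<pi> \<and> \<pi> d \<noteq> {}}"

definition consistent :: "'p list \<Rightarrow> 'p test set \<Rightarrow> bool" where
  "consistent ts Th \<longleftrightarrow> consistent_atoms ts Th \<noteq> {}"

primrec atom_fun :: "'p set \<Rightarrow> ('p, 'a) choice \<Rightarrow> 'p test \<Rightarrow> 'a" where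
  "atom_fun T0 (Act a) = (\<lambda>d. a)"
| "atom_fun T0 (Ite t a b) =
     (\<lambda>d. if entails T0 d t then atom_fun T0 a d else atom_fun T0 b d)"

text \<open>A preference relation is a set \<open>R \<subseteq> C \<times> C\<close>, and \<open>(a, b) \<in> R\<close> says that \<open>a\<close> is weakly
  preferred to \<open>b\<close>. Sequences are lists, hence indexed from 0.\<close>

definition A1 :: "('p, 'a) choice set \<Rightarrow> ('p, 'a) choice rel \<Rightarrow> bool" where
  "A1 C R \<longleftrightarrow> (\<forall>a\<in>C. \<forall>b\<in>C. (a, b) \<in> R \<or> (b, a) \<in> R)"

definition cancellation ::
    "'p list \<Rightarrow> 'p test set \<Rightarrow> ('p, 'a) choice set \<Rightarrow> ('p, 'a) choice rel
     \<Rightarrow> ('p, 'a) choice list \<Rightarrow> ('p, 'a) choice list \<Rightarrow> nat \<Rightarrow> bool" where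
  "cancellation ts Th C R as bs k \<longleftrightarrow>
     (set as \<subseteq> C \<and> set bs \<subseteq> C \<and> length as = length bs \<and> k < length as \<and>
      (\<forall>d\<in>consistent_atoms ts Th.
         mset (map (\<lambda>a. atom_fun (set ts) a d) as) = mset (map (\<lambda>b. atom_fun (set ts) b d) bs)) \<and>
      (\<forall>i<k. (as ! i, bs ! i) \<in> R) \<and>
      (\<forall>i\<in>{k..<length as}. as ! i = as ! k \<and> bs ! i = bs ! k)
      \<longrightarrow> (last bs, last as) \<in> R)"

definition A2' ::
    "'p list \<Rightarrow> 'p test set \<Rightarrow> ('p, 'a) choice set \<Rightarrow> ('p, 'a) choice rel \<Rightarrow> bool" where
  "A2' ts Th C R \<longleftrightarrow> (\<forall>as bs k. cancellation ts Th C R as bs k)"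

definition A2 ::
    "'p list \<Rightarrow> 'p test set \<Rightarrow> ('p, 'a) choice set \<Rightarrow> ('p, 'a) choice rel \<Rightarrow> bool" where
  "A2 ts Th C R \<longleftrightarrow> (\<forall>as bs. cancellation ts Th C R as bs (length as - 1))"

definition extensions ::
    "'p list \<Rightarrow> 'p test set \<Rightarrow> ('p, 'a) choice set \<Rightarrow> ('p, 'a) choice rel
     \<Rightarrow> ('p, 'a) choice rel set" where
  "extensions ts Th C R = {R'. R' \<subseteq> C \<times> C \<and> A1 C R' \<and> R \<subseteq> R' \<and> A2 ts Th C R'}"

definition exp_util ::
    "'s set \<Rightarrow> ('p test \<Rightarrow> 's set) \<Rightarrow> ('a \<Rightarrow> 's \<Rightarrow> 'o) \<Rightarrow> ('o \<Rightarrow> real) \<Rightarrow> 's pmf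
     \<Rightarrow> ('p, 'a) choice \<Rightarrow> real" where
  "exp_util S \<pi> \<rho> u p a = (\<Sum>s\<in>S. u (choice_interp \<pi> \<rho> a s) * pmf p s)"

definition SEU_rep ::
    "'p set \<Rightarrow> 'a set \<Rightarrow> 'p test set \<Rightarrow> ('p, 'a) choice set \<Rightarrow> ('p, 'a) choice rel
     \<Rightarrow> 's set \<Rightarrow> 'o set \<Rightarrow> ('o \<Rightarrow> real) set \<Rightarrow> 's pmf set \<Rightarrow> (('o \<Rightarrow> real) \<times> 's pmf) set
     \<Rightarrow> ('p test \<Rightarrow> 's set) \<Rightarrow> ('a \<Rightarrow> 's \<Rightarrow> 'o) \<Rightarrow> bool" where
  "SEU_rep T0 A0 Th C R S Out U P V \<pi> \<rho> \<longleftrightarrow>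
     finite S \<and> finite Out \<and>
     (\<forall>p\<in>P. set_pmf p \<subseteq> S) \<and>
     V \<subseteq> U \<times> P \<and>
     test_interp T0 S \<pi> \<and> respects_theory Th S \<pi> \<and>
     (\<forall>a\<in>A0. \<forall>s\<in>S. \<rho> a s \<in> Out) \<and>
     (\<forall>a\<in>C. \<forall>b\<in>C. (a, b) \<in> R \<longleftrightarrow>
        (\<forall>(u, p)\<in>V. exp_util S \<pi> \<rho> u p a \<ge> exp_util S \<pi> \<rho> u p b))"

text \<open>States and outcomes form finite sets, so natural numbers suffice to name them;
  see \<open>has_SEU_repI\<close> below.\<close>

definition has_SEU_rep ::
    "'p set \<Rightarrow> 'a set \<Rightarrow> 'p test set \<Rightarrow> ('p, 'a) choice set \<Rightarrow> ('p, 'a) choice rel \<Rightarrow> bool" where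
  "has_SEU_rep T0 A0 Th C R \<longleftrightarrow>
     (\<exists>(S::nat set) (Out::nat set) U P V \<pi> \<rho>. SEU_rep T0 A0 Th C R S Out U P V \<pi> \<rho>)"

lemma entails_any_states:
  assumes "entails T0 d t" "d \<in> tests T0" "t \<in> tests T0" "test_interp T0 S \<pi>"
  shows "\<pi> d \<subseteq> \<pi> t"
proof
  fix s assume s: "s \<in> \<pi> d"
  define \<pi>' where "\<pi>' = (\<lambda>t. if s \<in> \<pi> t then {0::nat} else {})"
  have "s \<in> S"
    using assms s by (auto simp: test_interp_def)
  then have "test_interp T0 {0} \<pi>'"
    using assms(4) by (auto simp: test_interp_def \<pi>'_def)
  then have "\<pi>' d \<subseteq> \<pi>' t"
    using assms(1) by (auto simp: entails_def)
  then show "s \<in> \<pi> t"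
    using s by (auto simp: \<pi>'_def split: if_splits)
qed

lemma atoms_subset_tests: "atoms ts \<subseteq> tests (set ts)"
proof -
  have "atoms ts \<subseteq> tests T0" if "set ts \<subseteq> T0" for T0
    using that by (induction ts rule: atoms.induct) (auto intro: tests.intros)
  then show ?thesis by blast
qed

lemma consistent_atoms_any_states:
  assumes "d \<in> atoms ts" "test_interp (set ts) S \<pi>" "respects_theory Th S \<pi>" "\<pi> d \<noteq> {}"
  shows "d \<in> consistent_atoms ts Th"
proof -
  obtain s where s: "s \<in> \<pi> d" using assms(4) by blast
  define \<pi>' where "\<pi>' = (\<lambda>t. if s \<in> \<pi> t then {0::nat} else {})"
  have "s \<in> S"
    using assms s atoms_subset_tests by (fastforce simp: test_interp_def)
  then have "test_interp (set ts) {0} \<pi>'" "respects_theory Th {0} \<pi>'"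
    using assms by (auto simp: test_interp_def respects_theory_def \<pi>'_def)
  moreover have "\<pi>' d \<noteq> {}" using s by (simp add: \<pi>'_def)
  ultimately show ?thesis
    using assms(1) unfolding consistent_atoms_def by blast
qed

lemma choice_interp_mem:
  assumes "\<And>a s. a \<in> A0 \<Longrightarrow> s \<in> S \<Longrightarrow> \<rho> a s \<in> Out" "a \<in> choices A0 T0" "s \<in> S"
  shows "choice_interp \<pi> \<rho> a s \<in> Out"
  using assms(2) by induction (auto simp: assms)

lemma SEU_rep_transport:
  assumes rep: "SEU_rep T0 A0 Th C R S Out U P V \<pi> \<rho>"
    and C: "C \<subseteq> choices A0 T0" and Th: "Th \<subseteq> tests T0"
    and g: "inj_on g S" and h: "inj_on h Out"
  defines "k \<equiv> \<lambda>u. u \<circ> inv_into Out h"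
  shows "SEU_rep T0 A0 Th C R (g ` S) (h ` Out) (k ` U) (map_pmf g ` P) (map_prod k (map_pmf g) ` V)
           (\<lambda>t. g ` \<pi> t) (\<lambda>a s. h (\<rho> a (inv_into S g s)))"
proof -
  let ?\<pi> = "\<lambda>t. g ` \<pi> t" and ?\<rho> = "\<lambda>a s. h (\<rho> a (inv_into S g s))"
  note r = rep[unfolded SEU_rep_def]
  have \<pi>S: "\<pi> t \<subseteq> S" if "t \<in> tests T0" for t
    using r that by (auto simp: test_interp_def)
  have ci: "choice_interp ?\<pi> ?\<rho> a (g s) = h (choice_interp \<pi> \<rho> a s)"
    if "a \<in> choices A0 T0" "s \<in> S" for a s
    using that(1)
  proof induction
    case (act a)
    then show ?case using g that(2) by simp
  next
    case (ite t a b)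
    have "g s \<in> g ` \<pi> t \<longleftrightarrow> s \<in> \<pi> t"
      using inj_on_image_mem_iff[OF g that(2) \<pi>S[OF ite(1)]] .
    then show ?case using ite by simp
  qed
  have eu: "exp_util (g ` S) ?\<pi> ?\<rho> (k u) (map_pmf g p) a = exp_util S \<pi> \<rho> u p a"
    if "p \<in> P" "a \<in> C" for u p a
  proof -
    have a: "a \<in> choices A0 T0" using C that by blast
    have pS: "set_pmf p \<subseteq> S" using r that by blast
    have "pmf (map_pmf g p) (g s) = pmf p s" if "s \<in> S" for s
    proof -
      have "pmf (map_pmf g p) (g s) = measure p (g -` {g s} \<inter> set_pmf p)"
        by (simp add: pmf_map measure_Int_set_pmf)
      also have "g -` {g s} \<inter> set_pmf p = {s} \<inter> set_pmf p"
        using pS g that by (auto dest: inj_onD)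
      also have "measure p \<dots> = pmf p s"
        by (simp add: measure_Int_set_pmf pmf.rep_eq)
      finally show ?thesis .
    qed
    moreover have "k u (h (choice_interp \<pi> \<rho> a s)) = u (choice_interp \<pi> \<rho> a s)" if "s \<in> S" for s
    proof -
      have "choice_interp \<pi> \<rho> a s \<in> Out"
        by (rule choice_interp_mem[OF _ a that]) (use r in blast)
      then show ?thesis using h by (simp add: k_def)
    qed
    ultimately show ?thesis
      unfolding exp_util_def by (simp add: sum.reindex[OF g] ci[OF a])
  qed
  have ti: "test_interp T0 (g ` S) ?\<pi>"
    unfolding test_interp_def
  proof (intro conjI ballI)
    fix t t' assume t: "t \<in> tests T0" and t': "t' \<in> tests T0"
    have "\<pi> (And t t') = \<pi> t \<inter> \<pi> t'" using r t t' by (auto simp: test_interp_def)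
    then show "g ` \<pi> (And t t') = g ` \<pi> t \<inter> g ` \<pi> t'"
      using inj_on_image_Int[OF g \<pi>S[OF t] \<pi>S[OF t']] by simp
  next
    fix t assume t: "t \<in> tests T0"
    show "g ` \<pi> t \<subseteq> g ` S" using \<pi>S[OF t] by blast
    have "\<pi> (Neg t) = S - \<pi> t" using r t by (auto simp: test_interp_def)
    then show "g ` \<pi> (Neg t) = g ` S - g ` \<pi> t"
      using inj_on_image_set_diff[OF g _ \<pi>S[OF t]] by simp
  qed
  have VP: "V \<subseteq> U \<times> P" using r by blast
  have "(a, b) \<in> R \<longleftrightarrow> (\<forall>(u, p)\<in>map_prod k (map_pmf g) ` V.
      exp_util (g ` S) ?\<pi> ?\<rho> u p a \<ge> exp_util (g ` S) ?\<pi> ?\<rho> u p b)" if "a \<in> C" "b \<in> C" for a b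
  proof -
    have "(a, b) \<in> R \<longleftrightarrow> (\<forall>(u, p)\<in>V. exp_util S \<pi> \<rho> u p a \<ge> exp_util S \<pi> \<rho> u p b)"
      using r that by blast
    also have "\<dots> \<longleftrightarrow> (\<forall>(u, p)\<in>V. exp_util (g ` S) ?\<pi> ?\<rho> (k u) (map_pmf g p) a
        \<ge> exp_util (g ` S) ?\<pi> ?\<rho> (k u) (map_pmf g p) b)"
      using VP that by (intro ball_cong refl) (auto simp: eu)
    finally show ?thesis by (auto simp: split_beta)
  qed
  moreover have "map_prod k (map_pmf g) ` V \<subseteq> k ` U \<times> map_pmf g ` P"
    using VP by auto
  moreover have "respects_theory Th (g ` S) ?\<pi>"
    using r by (auto simp: respects_theory_def)
  moreover have "\<forall>p\<in>map_pmf g ` P. set_pmf p \<subseteq> g ` S"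
    using r by fastforce
  moreover have "\<forall>a\<in>A0. \<forall>s\<in>g ` S. ?\<rho> a s \<in> h ` Out"
    using r g by auto
  ultimately show ?thesis
    using r ti unfolding SEU_rep_def by blast
qed

lemma has_SEU_repI:
  assumes "SEU_rep T0 A0 Th C R S Out U P V \<pi> \<rho>" "C \<subseteq> choices A0 T0" "Th \<subseteq> tests T0"
  shows "has_SEU_rep T0 A0 Th C R"
proof -
  have "finite S" "finite Out" using assms(1) by (auto simp: SEU_rep_def)
  then obtain g :: "_ \<Rightarrow> nat" and h :: "_ \<Rightarrow> nat" where "inj_on g S" "inj_on h Out"
    by (metis finite_imp_inj_to_nat_seg)
  from SEU_rep_transport[OF assms this] show ?thesis
    unfolding has_SEU_rep_def by blast
qed

end

theory Submission
  imports Defs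
begin

text \<open>For weights \<open>w\<close> on pairs of a consistent atom and a primitive choice, let the score of a choice
  \<open>a\<close> be the sum of \<open>w \<delta> (f\<^sub>a \<delta>)\<close> over the atoms \<open>\<delta>\<close>. Expected utilities are scores, scores are
  additive over the multisets in \<open>A2'\<close>, and hence every relation given by a set of scores satisfies
  \<open>A2'\<close>. Conversely, \<open>A2'\<close> says that \<open>a\<close> is preferred to \<open>b\<close> whenever the difference of their
  indicator vectors lies in the rational cone spanned by such differences for the preferred
  pairs; Farkas' lemma over the rationals turns a pair outside the relation into a
  score that respects all preferences and violates this one. A complete relation has a
  single score, the sum of finitely many of these. Each score is absorbed
  either into a state-dependent utility with the uniform distribution, or into
  its own copy of the atoms with one utility for all copies.\<close>

section \<open>Farkas' lemma over ordered fields, integer multipliers and counting\<close>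

text \<open>Induction on the number of constraints: if dropping constraint \<open>k\<close> breaks the implication, a
  witness \<open>z\<close> for that allows projecting along \<open>z\<close> onto the kernel of \<open>A k\<close>.\<close>

lemma farkas:
  fixes A :: "'j \<Rightarrow> 'i \<Rightarrow> 'f::linordered_field"
  assumes "finite J" "finite I"
    and "\<And>x. (\<forall>j\<in>J. (\<Sum>i\<in>I. A j i * x i) \<le> 0) \<Longrightarrow> (\<Sum>i\<in>I. c i * x i) \<le> 0"
  shows "\<exists>l. (\<forall>j\<in>J. 0 \<le> l j) \<and> (\<forall>i\<in>I. c i = (\<Sum>j\<in>J. l j * A j i))"
  using assms(1,3)
proof (induction J arbitrary: A c rule: finite_induct)
  case empty
  \<comment> \<open>Without constraints, \<open>c\<close> is nonpositive on every vector; evaluating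
    it at \<open>c\<close> itself forces it to vanish on \<open>I\<close>.\<close>
  have "(\<Sum>i\<in>I. c i * c i) \<le> 0" using empty[of c] by simp
  moreover have "(\<Sum>i\<in>I. c i * c i) \<ge> 0" by (rule sum_nonneg) simp
  ultimately have "(\<Sum>i\<in>I. c i * c i) = 0" by (rule order_antisym)
  then have "\<forall>i\<in>I. c i = 0"
    using sum_nonneg_eq_0_iff[OF assms(2), of "\<lambda>i. c i * c i"] by simp
  then show ?case by simp
next
  case (insert k J)
  define dot where "dot v x = (\<Sum>i\<in>I. v i * x i)" for v x :: "'i \<Rightarrow> 'f"
  have dot_lin: "dot v (\<lambda>i. x i - r * y i) = dot v x - r * dot v y" for v x y r
    by (simp add: dot_def algebra_simps sum_subtractf sum_distrib_left)
  have dot_lin': "dot (\<lambda>i. v i - r * v' i) x = dot v x - r * dot v' x" for v v' x r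
    by (simp add: dot_def algebra_simps sum_subtractf sum_distrib_left)
  have hyp: "dot c x \<le> 0" if "\<forall>j\<in>insert k J. dot (A j) x \<le> 0" for x
    using insert.prems[of x] that by (simp add: dot_def)
  show ?case
  proof (cases "\<forall>x. (\<forall>j\<in>J. dot (A j) x \<le> 0) \<longrightarrow> dot c x \<le> 0")
    case True
    then obtain l where l: "\<forall>j\<in>J. 0 \<le> l j" "\<forall>i\<in>I. c i = (\<Sum>j\<in>J. l j * A j i)"
      using insert.IH[of A c] unfolding dot_def by blast
    have "(\<Sum>j\<in>J. (l(k := 0)) j * A j i) = (\<Sum>j\<in>J. l j * A j i)" for i
      using insert.hyps by (intro sum.cong) auto
    then show ?thesis
      using l insert.hyps by (intro exI[of _ "l(k := 0)"]) auto
  next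
    case False
    then obtain y where y: "\<forall>j\<in>J. dot (A j) y \<le> 0" "dot c y > 0" by force
    then have pos: "dot (A k) y > 0" using hyp[of y] by force
    \<comment> \<open>Rescales \<open>y\<close> to have value 1 under \<open>A k\<close>. The
      difference form lets \<open>dot_lin\<close> compute its products.\<close>
    define z where "z = (\<lambda>i. 0 - (- 1 / dot (A k) y) * y i)"
    have dot_z: "dot v z = dot v y / dot (A k) y" for v
      unfolding z_def dot_lin by (simp add: dot_def)
    have z: "\<forall>j\<in>J. dot (A j) z \<le> 0" "dot c z > 0" "dot (A k) z = 1"
      using y pos by (auto simp: dot_z divide_nonpos_pos)
    define B where "B j = (\<lambda>i. A j i - dot (A j) z * A k i)" for j
    define e where "e = (\<lambda>i. c i - dot c z * A k i)"
    have "dot e x \<le> 0" if "\<forall>j\<in>J. dot (B j) x \<le> 0" for x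
    proof -
      let ?x = "\<lambda>i. x i - dot (A k) x * z i"
      have "dot (A j) ?x = dot (B j) x" for j
        unfolding B_def dot_lin dot_lin' by (simp add: mult.commute)
      moreover have "dot (A k) ?x = 0" unfolding dot_lin by (simp add: z(3))
      ultimately have "dot c ?x \<le> 0" using hyp[of ?x] that by simp
      moreover have "dot c ?x = dot e x"
        unfolding e_def dot_lin dot_lin' by (simp add: mult.commute)
      ultimately show ?thesis by simp
    qed
    then obtain l where l: "\<forall>j\<in>J. 0 \<le> l j" "\<forall>i\<in>I. e i = (\<Sum>j\<in>J. l j * B j i)"
      using insert.IH[of B e] unfolding dot_def by blast
    \<comment> \<open>The multiplier of \<open>k\<close> is forced by undoing the projection in
      \<open>c\<close> and in each \<open>A j\<close>. It is nonnegative since \<open>c\<close> is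
      positive at \<open>z\<close> and every \<open>A j\<close> with \<open>j \<in> J\<close> is
      nonpositive there.\<close>
    define l' where "l' = l(k := dot c z - (\<Sum>j\<in>J. l j * dot (A j) z))"
    have l': "l' j = l j" if "j \<in> J" for j
      using that insert.hyps by (auto simp: l'_def)
    have "(\<Sum>j\<in>J. l j * dot (A j) z) \<le> 0"
      using l z by (intro sum_nonpos) (auto simp: mult_nonneg_nonpos)
    then have "\<forall>j\<in>insert k J. 0 \<le> l' j"
      using l(1) z(2) l' by (auto simp: l'_def)
    moreover have "c i = (\<Sum>j\<in>insert k J. l' j * A j i)" if "i \<in> I" for i
    proof -
      have "c i = dot c z * A k i + (\<Sum>j\<in>J. l j * B j i)"
        using l(2) that by (auto simp: e_def algebra_simps)
      also have "(\<Sum>j\<in>J. l j * B j i)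
          = (\<Sum>j\<in>J. l j * A j i) - (\<Sum>j\<in>J. l j * dot (A j) z) * A k i"
        by (simp add: B_def algebra_simps sum_subtractf sum_distrib_left)
      also have "(\<Sum>j\<in>J. l j * A j i) = (\<Sum>j\<in>J. l' j * A j i)"
        by (intro sum.cong) (auto simp: l')
      finally show ?thesis
        using insert.hyps by (simp add: l'_def algebra_simps)
    qed
    ultimately show ?thesis by blast
  qed
qed

text \<open>Repetition counts in \<open>A2'\<close> are naturals, so the denominators of the
  rational multipliers from Farkas' lemma must be cleared. The denominator of each new entry is
  multiplied into the common one.\<close>

lemma common_denominator:
  fixes l :: "'j \<Rightarrow> rat"
  assumes "finite J" "\<forall>j\<in>J. 0 \<le> l j"
  shows "\<exists>m n. 0 < m \<and> (\<forall>j\<in>J. of_nat m * l j = of_nat (n j))"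
  using assms
proof (induction J rule: finite_induct)
  case empty
  then show ?case by (intro exI[of _ 1]) auto
next
  case (insert k J)
  then obtain m n where m: "0 < m" "\<forall>j\<in>J. of_nat m * l j = of_nat (n j)" by auto
  obtain p q where pq: "l k = Fract p q" "q > 0" by (cases "l k") auto
  then have "p \<ge> 0" using insert.prems by (auto simp: zero_le_Fract_iff)
  then have lk: "of_nat (nat q) * l k = of_nat (nat p)"
    using pq by (simp add: Fract_of_int_quotient)
  have "of_nat (m * nat q) * l j = of_nat ((if j = k then m * nat p else nat q * n j))"
    if "j \<in> insert k J" for j
    using that m(2) lk insert.hyps by (auto simp: mult.assoc mult.left_commute)
  then show ?case
    using m(1) pq(2) by (intro exI[of _ "m * nat q"]
        exI[of _ "\<lambda>j. if j = k then m * nat p else nat q * n j"]) auto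
qed

lemma sum_list_replicates:
  "sum_list (map g (concat (map (\<lambda>r. replicate (n r) r) xs))) = (\<Sum>r\<leftarrow>xs. n r * (g r :: nat))"
  by (induction xs) (auto simp: sum_list_replicate)

lemma count_mset_map: "count (mset (map f xs)) x = (\<Sum>a\<leftarrow>xs. of_bool (f a = x))"
  by (induction xs) auto

section \<open>Atoms and the tests they decide\<close>

lemma finite_atoms: "finite (atoms ts)"
proof (induction ts rule: atoms.induct)
  case (3 p q ps)
  have "atoms (p # q # ps) = (\<lambda>(l, d). And l d) ` ({Prim p, Neg (Prim p)} \<times> atoms (q # ps))"
    by force
  then show ?case using 3 by simp
qed auto

lemma finite_consistent_atoms: "finite (consistent_atoms ts Th)"
  unfolding consistent_atoms_def using finite_atoms[of ts] by simp

lemma tests_mono: "A \<subseteq> B \<Longrightarrow> tests A \<subseteq> tests B"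
proof
  show "t \<in> tests B" if "A \<subseteq> B" "t \<in> tests A" for t
    using that(2,1) by induction (auto intro: tests.intros)
qed

text \<open>Entailment is taken over a fixed \<open>T0\<close> rather than \<open>set ts\<close>,
  because the induction shortens the list while the language must stay the same.\<close>

lemma atom_entails_literal:
  assumes "d \<in> atoms ts" "set ts \<subseteq> T0" "p \<in> set ts"
  shows "entails T0 d (Prim p) \<or> entails T0 d (Neg (Prim p))"
  using assms
proof (induction ts arbitrary: d rule: atoms.induct)
  case (3 p' q ps)
  then obtain l d' where d: "d = And l d'" "l \<in> {Prim p', Neg (Prim p')}" "d' \<in> atoms (q # ps)"
    by auto
  have "l \<in> tests T0"
    using d(2) 3(3) by (auto intro: tests.intros)
  moreover have "d' \<in> tests T0"
    using d(3) 3(3) atoms_subset_tests[of "q # ps"] tests_mono[of "set (q # ps)" T0] by auto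
  ultimately have "entails T0 d l" "entails T0 d' t \<Longrightarrow> entails T0 d t" for t
    unfolding entails_def test_interp_def d(1) by blast+
  then show ?case
    using 3 d by (cases "p = p'") auto
qed (auto simp: entails_def)

text \<open>Induction on the test: the literals of the atom settle the primitive tests, and each
  connective is settled by its arguments; a conjunction is refuted as soon as one conjunct
  is.\<close>

lemma atom_decides:
  assumes d: "d \<in> atoms ts" and t: "t \<in> tests (set ts)"
  shows "entails (set ts) d t \<or> entails (set ts) d (Neg t)"
  using t
proof induction
  case (prim p)
  then show ?case using atom_entails_literal[OF d] by simp
next
  case (conj t t')
  show ?case
  proof (cases "entails (set ts) d t \<and> entails (set ts) d t'")
    case True
    have "\<pi> d \<subseteq> \<pi> (And t t')" if "test_interp (set ts) S \<pi>" for S :: "nat set" and \<pi>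
    proof -
      have "\<pi> d \<subseteq> \<pi> t" "\<pi> d \<subseteq> \<pi> t'" using True that by (auto simp: entails_def)
      moreover have "\<pi> (And t t') = \<pi> t \<inter> \<pi> t'"
        using that conj(1,2) by (simp add: test_interp_def)
      ultimately show ?thesis by blast
    qed
    then show ?thesis by (simp add: entails_def)
  next
    case False
    then have neg: "entails (set ts) d (Neg t) \<or> entails (set ts) d (Neg t')"
      using conj.IH by blast
    have "\<pi> d \<subseteq> \<pi> (Neg (And t t'))"
      if ti: "test_interp (set ts) S \<pi>" for S :: "nat set" and \<pi>
    proof -
      have "\<pi> d \<subseteq> \<pi> (Neg t) \<or> \<pi> d \<subseteq> \<pi> (Neg t')"
        using neg ti unfolding entails_def by blast
      moreover have "\<pi> (And t t') = \<pi> t \<inter> \<pi> t'" "\<pi> (Neg t) = S - \<pi> t" "\<pi> (Neg t') = S - \<pi> t'"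
        "\<pi> (Neg (And t t')) = S - \<pi> (And t t')"
        using ti conj(1,2) tests.conj[OF conj(1,2)] by (simp_all add: test_interp_def)
      ultimately show ?thesis by blast
    qed
    then show ?thesis by (simp add: entails_def)
  qed
next
  case (neg t)
  have "entails (set ts) d (Neg (Neg t))" if t: "entails (set ts) d t"
    unfolding entails_def
  proof (intro allI impI)
    fix S :: "nat set" and \<pi> assume ti: "test_interp (set ts) S \<pi>"
    then have "\<pi> (Neg (Neg t)) = S - (S - \<pi> t)" "\<pi> t \<subseteq> S"
      using neg(1) tests.neg[OF neg(1)] by (simp_all add: test_interp_def)
    then show "\<pi> d \<subseteq> \<pi> (Neg (Neg t))" using t ti unfolding entails_def by blast
  qed
  then show ?case using neg.IH by blast
qed

text \<open>A consistent atom is nonempty in some interpretation, where it cannot lie in both a set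
  and its complement. Together with \<open>atom_decides\<close>, this makes entailment commute with
  negation when consistent atoms serve as states.\<close>

lemma consistent_atom_not_both:
  assumes "d \<in> consistent_atoms ts Th" "t \<in> tests (set ts)"
    "entails (set ts) d t" "entails (set ts) d (Neg t)"
  shows False
proof -
  obtain S :: "nat set" and \<pi> where ti: "test_interp (set ts) S \<pi>" and "\<pi> d \<noteq> {}"
    using assms(1) unfolding consistent_atoms_def by blast
  moreover have "\<pi> d \<subseteq> \<pi> t" "\<pi> d \<subseteq> \<pi> (Neg t)"
    using ti assms(3,4) by (simp_all add: entails_def)
  moreover have "\<pi> (Neg t) = S - \<pi> t" using ti assms(2) by (simp add: test_interp_def)
  ultimately show False by blast
qed

text \<open>An atom failing to entail \<open>t\<close> would entail its negation, which is empty in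
  the interpretation that witnesses consistency with \<open>Th\<close>.\<close>

lemma consistent_atom_theory:
  assumes "d \<in> consistent_atoms ts Th" "t \<in> Th" "Th \<subseteq> tests (set ts)"
  shows "entails (set ts) d t"
proof (rule ccontr)
  assume "\<not> entails (set ts) d t"
  then have n: "entails (set ts) d (Neg t)"
    using assms atom_decides unfolding consistent_atoms_def by blast
  obtain S :: "nat set" and \<pi> where "test_interp (set ts) S \<pi>" "\<pi> d \<noteq> {}" "\<pi> t = S"
    using assms unfolding consistent_atoms_def respects_theory_def by blast
  with n assms(2,3) show False unfolding entails_def test_interp_def by blast
qed

text \<open>For each primitive test, take the literal true at \<open>s\<close>; the conjunction of
  these literals is the atom.\<close>

lemma atoms_cover:
  assumes "test_interp T0 S \<pi>" "s \<in> S" "set ts \<subseteq> T0" "ts \<noteq> []"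
  shows "\<exists>d\<in>atoms ts. s \<in> \<pi> d"
  using assms(3,4)
proof (induction ts rule: atoms.induct)
  case (2 p)
  then show ?case using assms(1,2) by (auto simp: test_interp_def intro: tests.prim)
next
  case (3 p q ps)
  then obtain d where d: "d \<in> atoms (q # ps)" "s \<in> \<pi> d" by auto
  have p: "Prim p \<in> tests T0" using 3 by (auto intro: tests.prim)
  define l where "l = (if s \<in> \<pi> (Prim p) then Prim p else Neg (Prim p))"
  have "s \<in> \<pi> l" "l \<in> tests T0"
    using p assms(1,2) by (auto simp: l_def test_interp_def intro: tests.neg)
  moreover have "d \<in> tests T0"
    using d(1) 3(2) atoms_subset_tests[of "q # ps"] tests_mono[of "set (q # ps)" T0] by auto
  ultimately have "s \<in> \<pi> (And l d)" using d assms(1) by (auto simp: test_interp_def)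
  moreover have "And l d \<in> atoms (p # q # ps)" using d by (auto simp: l_def)
  ultimately show ?case by blast
qed auto

text \<open>At a state inside the atom a test holds exactly when the atom entails it, so evaluation
  at the state and evaluation at the atom take the same branches.\<close>

lemma choice_interp_atom:
  assumes "test_interp (set ts) S \<pi>" "d \<in> atoms ts" "s \<in> \<pi> d" "a \<in> choices A0 (set ts)"
  shows "choice_interp \<pi> \<rho> a s = \<rho> (atom_fun (set ts) a d) s"
  using assms(4)
proof induction
  case (ite t a b)
  have d: "d \<in> tests (set ts)" using assms(2) atoms_subset_tests by blast
  have "s \<in> \<pi> t \<longleftrightarrow> entails (set ts) d t"
  proof
    assume "s \<in> \<pi> t"
    then have "s \<notin> \<pi> (Neg t)" using ite(1) assms(1) by (auto simp: test_interp_def)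
    then show "entails (set ts) d t"
      using atom_decides[OF assms(2) ite(1)] entails_any_states[OF _ d tests.neg[OF ite(1)] assms(1)]
        assms(3) by blast
  next
    assume "entails (set ts) d t"
    then show "s \<in> \<pi> t" using entails_any_states[OF _ d ite(1) assms(1)] assms(3) by blast
  qed
  then show ?case using ite by simp
qed simp

section \<open>Scores and profiles of choices\<close>

lemma atom_fun_mem: "a \<in> choices A0 T0 \<Longrightarrow> atom_fun T0 a d \<in> A0"
  by (induction rule: choices.induct) auto

text \<open>The codomain is generic because Farkas' lemma is applied with rational weights while
  utilities are real.\<close>

definition score :: "'p list \<Rightarrow> 'p test set \<Rightarrow> ('p test \<Rightarrow> 'a \<Rightarrow> 'f::comm_monoid_add)
    \<Rightarrow> ('p, 'a) choice \<Rightarrow> 'f" where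
  "score ts Th w a = (\<Sum>d\<in>consistent_atoms ts Th. w d (atom_fun (set ts) a d))"

text \<open>The restriction makes equality of profiles mean agreement on the consistent atoms alone,
  and leaves only finitely many profiles when \<open>A0\<close> is finite.\<close>

definition profile :: "'p list \<Rightarrow> 'p test set \<Rightarrow> ('p, 'a) choice \<Rightarrow> 'p test \<Rightarrow> 'a" where
  "profile ts Th a = restrict (atom_fun (set ts) a) (consistent_atoms ts Th)"

lemma atom_fun_eq_if_profile_eq:
  assumes "profile ts Th a = profile ts Th b" "d \<in> consistent_atoms ts Th"
  shows "atom_fun (set ts) a d = atom_fun (set ts) b d"
  using fun_cong[OF assms(1), of d] assms(2) by (simp add: profile_def)

lemma score_eq_if_profile_eq:
  "profile ts Th a = profile ts Th b \<Longrightarrow> score ts Th w a = score ts Th w b"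
  unfolding score_def by (intro sum.cong) (auto dest: atom_fun_eq_if_profile_eq)

lemma profile_mem:
  "a \<in> choices A0 (set ts) \<Longrightarrow> profile ts Th a \<in> (\<Pi>\<^sub>E d\<in>consistent_atoms ts Th. A0)"
  by (auto simp: profile_def intro: atom_fun_mem)

lemma finite_profiles:
  assumes "finite A0" "C \<subseteq> choices A0 (set ts)"
  shows "finite (profile ts Th ` C)"
proof (rule finite_subset)
  show "profile ts Th ` C \<subseteq> (\<Pi>\<^sub>E d\<in>consistent_atoms ts Th. A0)"
    by (rule image_subsetI) (rule profile_mem[OF subsetD[OF assms(2)]])
  show "finite (\<Pi>\<^sub>E d\<in>consistent_atoms ts Th. A0)"
    by (intro finite_PiE finite_consistent_atoms assms)
qed

text \<open>\<open>C\<close> may be infinite, but only finitely many pairs differ in their profiles.\<close>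

lemma finite_profile_representatives:
  assumes "finite A0" "C \<subseteq> choices A0 (set ts)" "R \<subseteq> C \<times> C"
  obtains R0 where "finite R0" "R0 \<subseteq> R"
    "\<And>a b. (a, b) \<in> R \<Longrightarrow> \<exists>a' b'. (a', b') \<in> R0 \<and>
       profile ts Th a' = profile ts Th a \<and> profile ts Th b' = profile ts Th b"
proof -
  let ?F = "map_prod (profile ts Th) (profile ts Th)"
  have "?F ` R \<subseteq> profile ts Th ` C \<times> profile ts Th ` C" using assms(3) by auto
  then have "finite (?F ` R)"
    using finite_profiles[OF assms(1,2)] by (meson finite_SigmaI finite_subset)
  then obtain R0 where R0: "R0 \<subseteq> R" "finite R0" "?F ` R = ?F ` R0"
    using finite_subset_image[of "?F ` R" ?F R] by blast
  show ?thesis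
  proof (rule that[OF R0(2,1)])
    fix a b assume "(a, b) \<in> R"
    then have "?F (a, b) \<in> ?F ` R0" using R0(3) by blast
    then obtain r where "?F (a, b) = ?F r" "r \<in> R0" by (rule imageE)
    then obtain a' b' where "(a', b') \<in> R0" "?F (a, b) = ?F (a', b')" by (cases r) blast
    then show "\<exists>a' b'. (a', b') \<in> R0 \<and>
       profile ts Th a' = profile ts Th a \<and> profile ts Th b' = profile ts Th b"
      unfolding map_prod_simp prod.inject by metis
  qed
qed

section \<open>Relations given by scores satisfy cancellation\<close>

text \<open>After exchanging the sums, each atom contributes a sum over the multiset of values at
  that atom, and these multisets agree.\<close>

lemma sum_list_score_eq:
  assumes "\<forall>d\<in>consistent_atoms ts Th.
      mset (map (\<lambda>a. atom_fun (set ts) a d) as) = mset (map (\<lambda>b. atom_fun (set ts) b d) bs)"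
  shows "(\<Sum>a\<leftarrow>as. score ts Th w a) = (\<Sum>b\<leftarrow>bs. score ts Th w b)"
proof -
  have swap: "(\<Sum>a\<leftarrow>xs. score ts Th w a)
      = (\<Sum>d\<in>consistent_atoms ts Th. \<Sum>\<^sub># (image_mset (w d) (mset (map (\<lambda>a. atom_fun (set ts) a d) xs))))"
    for xs
    by (induction xs) (auto simp: score_def sum.distrib)
  show ?thesis unfolding swap using assms by simp
qed

text \<open>If some score ranked \<open>bs ! k\<close> strictly below \<open>as ! k\<close>, every
  position would weakly favour \<open>as\<close> and position \<open>k\<close> strictly so, although
  the total scores agree.\<close>

lemma A2'_if_scores:
  fixes W :: "('p test \<Rightarrow> 'a \<Rightarrow> real) set"
  assumes W: "\<And>a b. a \<in> C \<Longrightarrow> b \<in> C \<Longrightarrow>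
      (a, b) \<in> R \<longleftrightarrow> (\<forall>w\<in>W. score ts Th w a \<ge> score ts Th w b)"
  shows "A2' ts Th C R"
  unfolding A2'_def cancellation_def
proof (intro allI impI, elim conjE)
  fix as bs :: "('p, 'a) choice list" and k
  assume C: "set as \<subseteq> C" "set bs \<subseteq> C" and len: "length as = length bs" "k < length as"
    and ms: "\<forall>d\<in>consistent_atoms ts Th.
         mset (map (\<lambda>a. atom_fun (set ts) a d) as) = mset (map (\<lambda>b. atom_fun (set ts) b d) bs)"
    and R: "\<forall>i<k. (as ! i, bs ! i) \<in> R"
    and c: "\<forall>i\<in>{k..<length as}. as ! i = as ! k \<and> bs ! i = bs ! k"
  have ne: "as \<noteq> []" "bs \<noteq> []" using len by auto
  have "length as - 1 \<in> {k..<length as}" using len by auto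
  from bspec[OF c this] have last: "last as = as ! k" "last bs = bs ! k"
    using ne len(1) by (simp_all add: last_conv_nth)
  have inC: "as ! i \<in> C" "bs ! i \<in> C" if "i < length as" for i
    using subsetD[OF C(1) nth_mem] subsetD[OF C(2) nth_mem] that len(1) by simp_all
  have "score ts Th w (bs ! k) \<ge> score ts Th w (as ! k)" if w: "w \<in> W" for w
  proof (rule ccontr)
    let ?v = "score ts Th w"
    assume neg: "\<not> ?thesis"
    have "(\<Sum>i<length as. ?v (bs ! i)) < (\<Sum>i<length as. ?v (as ! i))"
    proof (rule sum_strict_mono_ex1)
      show "\<forall>i\<in>{..<length as}. ?v (bs ! i) \<le> ?v (as ! i)"
      proof
        fix i assume i: "i \<in> {..<length as}"
        show "?v (bs ! i) \<le> ?v (as ! i)"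
        proof (cases "i < k")
          case True
          then show ?thesis using R W[of "as ! i" "bs ! i"] inC[of i] i w by auto
        next
          case False
          then have "as ! i = as ! k" "bs ! i = bs ! k" using bspec[OF c, of i] i by simp_all
          then show ?thesis using neg by simp
        qed
      qed
      show "\<exists>i\<in>{..<length as}. ?v (bs ! i) < ?v (as ! i)"
        using neg len by (intro bexI[of _ k]) auto
    qed simp
    moreover have "(\<Sum>i<length as. ?v (bs ! i)) = (\<Sum>i<length as. ?v (as ! i))"
      using sum_list_score_eq[OF ms, of w] len
      by (simp add: sum_list_sum_nth atLeast0LessThan)
    ultimately show False by simp
  qed
  then show "(last bs, last as) \<in> R"
    using W[of "bs ! k" "as ! k"] inC[of k] len last by auto
qed

section \<open>From cancellation to separating scores\<close>

text \<open>The scalar product with the 0-1 vector of the graph of \<open>atom_fun\<close> is the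
  finite-dimensional form that Farkas' lemma needs.\<close>

lemma score_eq_dot:
  fixes w :: "'p test \<times> 'a \<Rightarrow> 'f::comm_semiring_1"
  assumes "finite A0" "a \<in> choices A0 (set ts)"
  shows "(\<Sum>i\<in>consistent_atoms ts Th \<times> A0. of_bool (atom_fun (set ts) a (fst i) = snd i) * w i)
    = score ts Th (\<lambda>d x. w (d, x)) a"
proof -
  have "(\<Sum>x\<in>A0. of_bool (atom_fun (set ts) a d = x) * w (d, x)) = w (d, atom_fun (set ts) a d)" for d
    using assms atom_fun_mem[OF assms(2)]
      by (simp add: of_bool_def if_distrib[of "\<lambda>x. x * _"] cong: if_cong)
  then show ?thesis
    unfolding score_def sum.cartesian_product' by simp
qed

text \<open>With denominators cleared, \<open>eq\<close> says that the pairs of \<open>R0\<close>,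
  suitably repeated, and copies of \<open>(b, a)\<close> balance at every consistent atom. Applying
  \<open>A2'\<close> to these lists gives the preference.\<close>

lemma A2'_conic_closed:
  fixes l :: "('p, 'a) choice \<times> ('p, 'a) choice \<Rightarrow> rat"
  assumes A2': "A2' ts Th C R" and fin: "finite R0" and R0: "R0 \<subseteq> R" and RC: "R \<subseteq> C \<times> C"
    and C: "C \<subseteq> choices A0 (set ts)" and ab: "a \<in> C" "b \<in> C"
    and l: "\<forall>r\<in>R0. 0 \<le> l r"
    and eq: "\<And>d x. d \<in> consistent_atoms ts Th \<Longrightarrow> x \<in> A0 \<Longrightarrow>
        of_bool (atom_fun (set ts) b d = x) - of_bool (atom_fun (set ts) a d = x)
        = (\<Sum>r\<in>R0. l r * (of_bool (atom_fun (set ts) (snd r) d = x)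
            - of_bool (atom_fun (set ts) (fst r) d = x)))"
  shows "(a, b) \<in> R"
proof -
  obtain m n where m: "0 < m" "\<forall>r\<in>R0. of_nat m * l r = of_nat (n r)"
    using common_denominator[OF fin l] by blast
  obtain rs where rs: "set rs = R0" "distinct rs" using finite_distinct_list[OF fin] by blast
  define L where "L = concat (map (\<lambda>r. replicate (n r) r) rs)"
  \<comment> \<open>The tail has \<open>b\<close> on the left and \<open>a\<close> on the right
    because \<open>A2'\<close> reverses the last pair; \<open>m > 0\<close> keeps the tail
    nonempty.\<close>
  let ?as = "map fst L @ replicate m b" and ?bs = "map snd L @ replicate m a"
  have L: "set L \<subseteq> R" using rs R0 by (auto simp: L_def)
  have sumL: "(\<Sum>r\<leftarrow>L. g r) = (\<Sum>r\<in>R0. n r * g r)" for g :: "_ \<Rightarrow> nat"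
    using rs unfolding L_def sum_list_replicates by (simp add: sum_list_distinct_conv_sum_set)
  have ms: "mset (map (\<lambda>a. atom_fun (set ts) a d) ?as) = mset (map (\<lambda>b. atom_fun (set ts) b d) ?bs)"
    if d: "d \<in> consistent_atoms ts Th" for d
  proof (rule multiset_eqI)
    fix x
    define j where "j a \<longleftrightarrow> atom_fun (set ts) a d = x" for a :: "('p, 'a) choice"
    have eqm: "(\<Sum>r\<in>R0. n r * of_bool (j (fst r))) + m * of_bool (j b) = (\<Sum>r\<in>R0. n r * of_bool (j (snd r))) + m * of_bool (j a)"
    proof (cases "x \<in> A0")
      case True
      have "of_nat m * (of_bool (j b) - of_bool (j a)) = (\<Sum>r\<in>R0. (of_nat m * l r) * (of_bool (j (snd r)) - of_bool (j (fst r))))"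
        using eq[OF d True] unfolding j_def by (simp add: sum_distrib_left mult.assoc)
      also have "\<dots> = (\<Sum>r\<in>R0. of_nat (n r) * (of_bool (j (snd r)) - of_bool (j (fst r))))"
        using m(2) by simp
      \<comment> \<open>Negative terms are moved across, so that the identity descends from the
        rationals to the naturals.\<close>
      finally have "rat_of_nat ((\<Sum>r\<in>R0. n r * of_bool (j (fst r))) + m * of_bool (j b))
          = rat_of_nat ((\<Sum>r\<in>R0. n r * of_bool (j (snd r))) + m * of_bool (j a))"
        by (simp add: sum_subtractf algebra_simps)
      then show ?thesis unfolding of_nat_eq_iff .
    next
      \<comment> \<open>No choice in \<open>C\<close> takes a value outside \<open>A0\<close>, so
        both counts are zero.\<close>
      case False
      then have "of_bool (j c) = 0" if "c \<in> C" for c :: "('p, 'a) choice"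
        using atom_fun_mem[of c A0 "set ts" d] that C by (auto simp: j_def)
      moreover have "fst r \<in> C" "snd r \<in> C" if "r \<in> R0" for r
        using that R0 RC by auto
      ultimately show ?thesis using ab False by simp
    qed
    show "count (mset (map (\<lambda>a. atom_fun (set ts) a d) ?as)) x
        = count (mset (map (\<lambda>b. atom_fun (set ts) b d) ?bs)) x"
      using eqm sumL[of "\<lambda>r. of_bool (j (fst r))"] sumL[of "\<lambda>r. of_bool (j (snd r))"]
      unfolding count_mset_map by (simp add: sum_list_replicate o_def j_def)
  qed
  have canc: "cancellation ts Th C R ?as ?bs (length L)" using A2' by (auto simp: A2'_def)
  have pref: "(?as ! i, ?bs ! i) \<in> R" if "i < length L" for i
    using that L nth_mem[OF that] by (auto simp: nth_append)
  have mem: "set ?as \<subseteq> C" "set ?bs \<subseteq> C" using L RC ab by (auto split: if_splits)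
  have const: "\<forall>i\<in>{length L..<length ?as}. ?as ! i = ?as ! length L \<and> ?bs ! i = ?bs ! length L"
    using m(1) by (auto simp: nth_append)
  have "length ?as = length ?bs" "length L < length ?as" using m(1) by simp_all
  then have "(last ?bs, last ?as) \<in> R"
    using canc[unfolded cancellation_def] mem ms pref const by blast
  then show ?thesis using m(1) by simp
qed

text \<open>If every rational weighting that respects \<open>R0\<close> ranked \<open>a\<close> at
  least as high as \<open>b\<close>, Farkas' lemma would express the difference vector of
  \<open>(a, b)\<close> as a nonnegative combination of those of \<open>R0\<close>, and
  \<open>A2'_conic_closed\<close> would put \<open>(a, b)\<close> in \<open>R\<close>.\<close>

lemma A2'_separation:
  assumes A2': "A2' ts Th C R" and A0: "finite A0" and C: "C \<subseteq> choices A0 (set ts)"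
    and RC: "R \<subseteq> C \<times> C" and ab: "a \<in> C" "b \<in> C" "(a, b) \<notin> R"
  shows "\<exists>w :: 'p test \<Rightarrow> 'a \<Rightarrow> real. (\<forall>(x, y)\<in>R. score ts Th w x \<ge> score ts Th w y) \<and>
    score ts Th w a < score ts Th w b"
proof -
  obtain R0 where R0: "finite R0" "R0 \<subseteq> R"
    and rep: "\<And>a b. (a, b) \<in> R \<Longrightarrow> \<exists>a' b'. (a', b') \<in> R0 \<and>
       profile ts Th a' = profile ts Th a \<and> profile ts Th b' = profile ts Th b"
    using finite_profile_representatives[OF A0 C RC] by blast
  let ?I = "consistent_atoms ts Th \<times> A0"
  define v where "v r i = (of_bool (atom_fun (set ts) (snd r) (fst i) = snd i)
      - of_bool (atom_fun (set ts) (fst r) (fst i) = snd i) :: rat)"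
    for r :: "('p, 'a) choice \<times> ('p, 'a) choice" and i
  have dot: "(\<Sum>i\<in>?I. v (x, y) i * w i)
      = score ts Th (\<lambda>d x. w (d, x)) y - score ts Th (\<lambda>d x. w (d, x)) x"
    if "x \<in> C" "y \<in> C" for x y w
    using score_eq_dot[OF A0 subsetD[OF C that(1)], of w Th]
      score_eq_dot[OF A0 subsetD[OF C that(2)], of w Th]
    by (simp add: v_def left_diff_distrib sum_subtractf)
  have "\<exists>w. (\<forall>r\<in>R0. (\<Sum>i\<in>?I. v r i * w i) \<le> 0) \<and> \<not> (\<Sum>i\<in>?I. v (a, b) i * w i) \<le> 0"
  proof (rule ccontr)
    assume "\<not> ?thesis"
    then have "\<exists>l. (\<forall>r\<in>R0. 0 \<le> l r) \<and> (\<forall>i\<in>?I. v (a, b) i = (\<Sum>r\<in>R0. l r * v r i))"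
      by (intro farkas R0 finite_SigmaI finite_consistent_atoms A0) blast+
    then obtain l where l: "\<forall>r\<in>R0. 0 \<le> l r"
      and "\<forall>i\<in>?I. v (a, b) i = (\<Sum>r\<in>R0. l r * v r i)" by blast
    then have "(a, b) \<in> R"
      by (intro A2'_conic_closed[OF A2' R0 RC C ab(1,2) l]) (force simp: v_def)
    with ab show False by blast
  qed
  then obtain w where w: "\<And>r. r \<in> R0 \<Longrightarrow> (\<Sum>i\<in>?I. v r i * w i) \<le> 0"
    "(\<Sum>i\<in>?I. v (a, b) i * w i) > 0" by force
  \<comment> \<open>Separation takes place over the rationals, where multipliers can be cleared to
    integers; the embedding into the reals preserves sums and order.\<close>
  define w' where "w' d x = real_of_rat (w (d, x))" for d x
  have sc: "score ts Th w' c = real_of_rat (score ts Th (\<lambda>d x. w (d, x)) c)" for c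
    by (simp add: score_def w'_def of_rat_sum)
  have "score ts Th w' x \<ge> score ts Th w' y" if xy: "(x, y) \<in> R" for x y
  proof -
    obtain x' y' where "(x', y') \<in> R0" and p: "profile ts Th x' = profile ts Th x"
      "profile ts Th y' = profile ts Th y" using rep[OF xy] by blast
    then have "score ts Th w' x' \<ge> score ts Th w' y'"
      using w(1)[of "(x', y')"] dot[of x' y' w] R0(2) RC by (auto simp: sc of_rat_less_eq)
    then show ?thesis using score_eq_if_profile_eq[OF p(1)] score_eq_if_profile_eq[OF p(2)] by metis
  qed
  moreover have "score ts Th w' a < score ts Th w' b"
    using w(2) dot[OF ab(1,2)] by (simp add: sc of_rat_less)
  ultimately show ?thesis by blast
qed

text \<open>Add up scores that separate finitely many representatives of the pairs outside
  \<open>R\<close>. If \<open>(a, b)\<close> is outside \<open>R\<close>, completeness puts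
  \<open>(b, a)\<close> in \<open>R\<close>, so every summand weakly ranks \<open>b\<close> above
  \<open>a\<close>, and the one of its representative does so strictly.\<close>

lemma A1_A2'_score:
  assumes A1: "A1 C R" and A2': "A2' ts Th C R" and A0: "finite A0" and C: "C \<subseteq> choices A0 (set ts)"
    and RC: "R \<subseteq> C \<times> C"
  shows "\<exists>w :: 'p test \<Rightarrow> 'a \<Rightarrow> real. \<forall>a\<in>C. \<forall>b\<in>C.
    (a, b) \<in> R \<longleftrightarrow> score ts Th w a \<ge> score ts Th w b"
proof -
  obtain N where N: "finite N" "N \<subseteq> C \<times> C - R"
    and rep: "\<And>a b. (a, b) \<in> C \<times> C - R \<Longrightarrow> \<exists>a' b'. (a', b') \<in> N \<and>
       profile ts Th a' = profile ts Th a \<and> profile ts Th b' = profile ts Th b"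
    using finite_profile_representatives[OF A0 C, of "C \<times> C - R" Th] by blast
  have "\<forall>r\<in>N. \<exists>w :: 'p test \<Rightarrow> 'a \<Rightarrow> real. (\<forall>(x, y)\<in>R. score ts Th w x \<ge> score ts Th w y) \<and>
    score ts Th w (fst r) < score ts Th w (snd r)"
  proof
    fix r assume "r \<in> N"
    then have "fst r \<in> C" "snd r \<in> C" "(fst r, snd r) \<notin> R" using N(2) by auto
    then show "\<exists>w :: 'p test \<Rightarrow> 'a \<Rightarrow> real. (\<forall>(x, y)\<in>R. score ts Th w x \<ge> score ts Th w y) \<and>
      score ts Th w (fst r) < score ts Th w (snd r)"
      by (rule A2'_separation[OF A2' A0 C RC])
  qed
  then obtain W :: "_ \<Rightarrow> 'p test \<Rightarrow> 'a \<Rightarrow> real" where W: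
    "\<And>r x y. r \<in> N \<Longrightarrow> (x, y) \<in> R \<Longrightarrow> score ts Th (W r) x \<ge> score ts Th (W r) y"
    "\<And>r. r \<in> N \<Longrightarrow> score ts Th (W r) (fst r) < score ts Th (W r) (snd r)"
    unfolding bchoice_iff by fast
  define w where "w d x = (\<Sum>r\<in>N. W r d x)" for d x
  have sc: "score ts Th w c = (\<Sum>r\<in>N. score ts Th (W r) c)" for c
    unfolding score_def w_def by (rule sum.swap)
  have "(a, b) \<in> R \<longleftrightarrow> score ts Th w a \<ge> score ts Th w b" if ab: "a \<in> C" "b \<in> C" for a b
  proof
    assume "(a, b) \<in> R"
    then show "score ts Th w a \<ge> score ts Th w b"
      unfolding sc using W(1) by (intro sum_mono) blast
  next
    assume ge: "score ts Th w a \<ge> score ts Th w b"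
    show "(a, b) \<in> R"
    proof (rule ccontr)
      assume nR: "(a, b) \<notin> R"
      then obtain a' b' where r: "(a', b') \<in> N" and p: "profile ts Th a' = profile ts Th a"
        "profile ts Th b' = profile ts Th b" using rep[of a b] ab by blast
      have "(b, a) \<in> R" using A1 nR ab unfolding A1_def by blast
      then have "score ts Th w a < score ts Th w b"
        unfolding sc
        using W(1) W(2)[OF r] r score_eq_if_profile_eq[OF p(1), of "W (a', b')"]
          score_eq_if_profile_eq[OF p(2), of "W (a', b')"]
        by (intro sum_strict_mono_ex1 N(1)) auto
      with ge show False by simp
    qed
  qed
  then show ?thesis by blast
qed

section \<open>Complete extensions\<close>

text \<open>Were the conclusion false, completeness would supply the preference at all positions
  from \<open>k\<close> on, since these repeat the last pair; \<open>A2\<close> then yields the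
  conclusion after all.\<close>

lemma A2'_if_A1_A2:
  fixes C :: "('p, 'a) choice set"
  assumes A1: "A1 C R" and A2: "A2 ts Th C R"
  shows "A2' ts Th C R"
  unfolding A2'_def cancellation_def
proof (intro allI impI, elim conjE)
  fix as bs :: "('p, 'a) choice list" and k
  assume C: "set as \<subseteq> C" "set bs \<subseteq> C" and len: "length as = length bs" "k < length as"
    and ms: "\<forall>d\<in>consistent_atoms ts Th.
         mset (map (\<lambda>a. atom_fun (set ts) a d) as) = mset (map (\<lambda>b. atom_fun (set ts) b d) bs)"
    and R: "\<forall>i<k. (as ! i, bs ! i) \<in> R"
    and c: "\<forall>i\<in>{k..<length as}. as ! i = as ! k \<and> bs ! i = bs ! k"
  have ne: "as \<noteq> []" "bs \<noteq> []" using len by auto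
  have "length as - 1 \<in> {k..<length as}" using len by auto
  from bspec[OF c this] have last: "last as = as ! k" "last bs = bs ! k"
    using ne len(1) by (simp_all add: last_conv_nth)
  show "(last bs, last as) \<in> R"
  proof (rule ccontr)
    assume n: "(last bs, last as) \<notin> R"
    then have "(last as, last bs) \<in> R"
      using A1 C ne unfolding A1_def by (meson last_in_set subsetD)
    then have "(as ! i, bs ! i) \<in> R" if "i < length as" for i
      using R bspec[OF c, of i] that last by (cases "i < k") simp_all
    moreover have "cancellation ts Th C R as bs (length as - 1)"
      using A2 by (simp add: A2_def)
    moreover have "{length as - 1..<length as} = {length as - 1}" using ne by (cases as) auto
    ultimately have "(last bs, last as) \<in> R"
      using C len ms unfolding cancellation_def by auto
    with n show False by blast
  qed
qed

text \<open>The sequences \<open>[a, b']\<close> and \<open>[b, a']\<close> have equal value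
  multisets at every consistent atom, so \<open>A2\<close> passes from \<open>(a, b)\<close> to
  \<open>(a', b')\<close>.\<close>

lemma A2_profile_invariant:
  assumes A2: "A2 ts Th C R" and "R \<subseteq> C \<times> C" "(a, b) \<in> R" "a' \<in> C" "b' \<in> C"
    and "profile ts Th a' = profile ts Th a" "profile ts Th b' = profile ts Th b"
  shows "(a', b') \<in> R"
proof -
  have "cancellation ts Th C R [a, b'] [b, a'] 1"
    using A2[unfolded A2_def, rule_format, of "[a, b']" "[b, a']"] by simp
  moreover have "{1..<2::nat} = {1}" by auto
  ultimately show ?thesis
    using assms atom_fun_eq_if_profile_eq[OF assms(6)] atom_fun_eq_if_profile_eq[OF assms(7)]
    unfolding cancellation_def by (auto simp: add_mset_commute numeral_2_eq_2)
qed

text \<open>By profile invariance an extension is determined by its set of profile pairs, and there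
  are finitely many such sets. The extensions form a factor of the state space, which has to be
  finite.\<close>

lemma finite_extensions:
  assumes "finite A0" "C \<subseteq> choices A0 (set ts)"
  shows "finite (extensions ts Th C R)"
proof -
  let ?F = "map_prod (profile ts Th) (profile ts Th)"
  have "inj_on ((`) ?F) (extensions ts Th C R)"
  proof (rule inj_onI)
    have sub: "R1 \<subseteq> R2" if "R1 \<in> extensions ts Th C R" "R2 \<in> extensions ts Th C R"
      "?F ` R1 = ?F ` R2" for R1 R2
    proof (clarify)
      fix a b assume ab: "(a, b) \<in> R1"
      then have "?F (a, b) \<in> ?F ` R2" using that(3) by blast
      then obtain a' b' where "(a', b') \<in> R2" "profile ts Th a = profile ts Th a'"
        "profile ts Th b = profile ts Th b'" by auto
      then show "(a, b) \<in> R2"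
        using A2_profile_invariant[of ts Th C R2 a' b' a b] that(1,2) ab
        by (auto simp: extensions_def)
    qed
    show "R1 = R2" if "R1 \<in> extensions ts Th C R" "R2 \<in> extensions ts Th C R"
      "?F ` R1 = ?F ` R2" for R1 R2
      using sub[OF that] sub[OF that(2,1) that(3)[symmetric]] by blast
  qed
  moreover have "(`) ?F ` extensions ts Th C R \<subseteq> Pow (profile ts Th ` C \<times> profile ts Th ` C)"
    by (fastforce simp: extensions_def)
  moreover have "finite (Pow (profile ts Th ` C \<times> profile ts Th ` C))"
    using finite_profiles[OF assms] by blast
  ultimately show ?thesis by (meson finite_imageD finite_subset)
qed

lemma A2_if_A2': "A2' ts Th C R \<Longrightarrow> A2 ts Th C R"
  by (simp add: A2'_def A2_def)

text \<open>A score separating a pair outside \<open>R\<close> induces a complete relation that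
  extends \<open>R\<close> and misses the pair. Preference thus becomes unanimity among the
  extensions.\<close>

lemma A2'_iff_all_extensions:
  assumes A2': "A2' ts Th C R" and A0: "finite A0" and C: "C \<subseteq> choices A0 (set ts)"
    and RC: "R \<subseteq> C \<times> C" and ab: "a \<in> C" "b \<in> C"
  shows "(a, b) \<in> R \<longleftrightarrow> (\<forall>R'\<in>extensions ts Th C R. (a, b) \<in> R')"
proof (intro iffI ballI)
  assume all: "\<forall>R'\<in>extensions ts Th C R. (a, b) \<in> R'"
  show "(a, b) \<in> R"
  proof (rule ccontr)
    assume "(a, b) \<notin> R"
    then obtain w :: "'a test \<Rightarrow> 'b \<Rightarrow> real" where w: "\<forall>(x, y)\<in>R. score ts Th w x \<ge> score ts Th w y"
      "score ts Th w a < score ts Th w b"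
      using A2'_separation[OF A2' A0 C RC ab] by blast
    define R' where "R' = {(x, y). x \<in> C \<and> y \<in> C \<and> score ts Th w x \<ge> score ts Th w y}"
    have "A2' ts Th C R'"
      by (rule A2'_if_scores[where W = "{w}"]) (auto simp: R'_def)
    then have "R' \<in> extensions ts Th C R"
      using w(1) RC by (auto simp: extensions_def A1_def R'_def intro!: A2_if_A2')
    with all w(2) show False by (auto simp: R'_def)
  qed
qed (auto simp: extensions_def)

section \<open>Translation between expected utilities and scores\<close>

text \<open>At each state a choice acts as the primitive choice it selects at an atom true there, so
  grouping the states by such atoms turns expected utility into a score.\<close>

lemma scores_if_SEU_rep:
  assumes rep: "SEU_rep (set ts) A0 Th C R S Out U P V \<pi> \<rho>"
    and C: "C \<subseteq> choices A0 (set ts)" and ts: "ts \<noteq> []"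
  shows "\<exists>W :: ('p test \<Rightarrow> 'a \<Rightarrow> real) set. \<forall>a\<in>C. \<forall>b\<in>C.
    (a, b) \<in> R \<longleftrightarrow> (\<forall>w\<in>W. score ts Th w a \<ge> score ts Th w b)"
proof -
  note r = rep[unfolded SEU_rep_def]
  have ti: "test_interp (set ts) S \<pi>" "respects_theory Th S \<pi>" "finite S" using r by auto
  have "\<forall>s\<in>S. \<exists>d. d \<in> atoms ts \<and> s \<in> \<pi> d"
    using atoms_cover[OF ti(1) _ order_refl ts] by blast
  then obtain \<delta> where \<delta>: "\<And>s. s \<in> S \<Longrightarrow> \<delta> s \<in> atoms ts" "\<And>s. s \<in> S \<Longrightarrow> s \<in> \<pi> (\<delta> s)"
    unfolding bchoice_iff by blast
  have \<delta>D: "\<delta> ` S \<subseteq> consistent_atoms ts Th"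
    using consistent_atoms_any_states[OF \<delta>(1) ti(1,2)] \<delta>(2) by blast
  \<comment> \<open>The weight of an atom collects the contributions of the states assigned to it;
    \<open>\<delta>\<close> fixes one atom per state, so no state is counted twice.\<close>
  define w where "w u p d x = (\<Sum>s\<in>{s\<in>S. \<delta> s = d}. u (\<rho> x s) * pmf p s)" for u :: "_ \<Rightarrow> real" and p d x
  have eu: "exp_util S \<pi> \<rho> u p a = score ts Th (w u p) a" if "a \<in> C" for u p a
  proof -
    have "a \<in> choices A0 (set ts)" using that C by blast
    then have "choice_interp \<pi> \<rho> a s = \<rho> (atom_fun (set ts) a (\<delta> s)) s" if "s \<in> S" for s
      by (rule choice_interp_atom[OF ti(1) \<delta>(1)[OF that] \<delta>(2)[OF that]])
    then have "exp_util S \<pi> \<rho> u p a = (\<Sum>s\<in>S. u (\<rho> (atom_fun (set ts) a (\<delta> s)) s) * pmf p s)"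
      unfolding exp_util_def by (intro sum.cong) auto
    also have "\<dots> = (\<Sum>d\<in>consistent_atoms ts Th. \<Sum>s\<in>{s\<in>S. \<delta> s = d}.
        u (\<rho> (atom_fun (set ts) a (\<delta> s)) s) * pmf p s)"
      by (rule sum.group[symmetric, OF ti(3) finite_consistent_atoms \<delta>D])
    also have "\<dots> = score ts Th (w u p) a"
      unfolding score_def w_def by (intro sum.cong) auto
    finally show ?thesis .
  qed
  show ?thesis
    using r eu by (intro exI[of _ "case_prod w ` V"]) (simp add: case_prod_unfold)
qed

text \<open>Outcomes are pairs of a state and a primitive choice, so a utility on outcomes is as
  good as a state-dependent one. Each distribution is uniform on one copy of the atoms, where
  expected utility is a score divided by \<open>card D\<close>. A one-element \<open>X\<close> gives
  a single distribution, a one-element \<open>U\<close> a single utility.\<close>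

lemma SEU_rep_product:
  fixes U :: "(('p test \<times> 'x) \<times> 'a \<Rightarrow> real) set"
  assumes A0: "finite A0" and Th: "Th \<subseteq> tests (set ts)" and con: "consistent ts Th" and X: "finite X"
    and R: "\<And>a b. a \<in> C \<Longrightarrow> b \<in> C \<Longrightarrow> (a, b) \<in> R \<longleftrightarrow>
      (\<forall>u\<in>U. \<forall>x\<in>X. score ts Th (\<lambda>d y. u ((d, x), y)) a \<ge> score ts Th (\<lambda>d y. u ((d, x), y)) b)"
  defines "D \<equiv> consistent_atoms ts Th"
  defines "P \<equiv> (\<lambda>x. pmf_of_set (D \<times> {x})) ` X"
  shows "SEU_rep (set ts) A0 Th C R (D \<times> X) ((D \<times> X) \<times> A0) U P (U \<times> P)
    (\<lambda>t. {s \<in> D \<times> X. entails (set ts) (fst s) t}) (\<lambda>a s. (s, a))"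
proof -
  let ?\<pi> = "\<lambda>t. {s \<in> D \<times> X. entails (set ts) (fst s) t}" and ?\<rho> = "\<lambda>(a::'a) (s::'p test \<times> 'x). (s, a)"
  have D: "finite D" "D \<noteq> {}"
    using con finite_consistent_atoms by (auto simp: D_def consistent_def)
  have DX: "finite (D \<times> {x})" "D \<times> {x} \<noteq> {}" for x :: 'x using D by auto
  have ci: "choice_interp ?\<pi> ?\<rho> a s = (s, atom_fun (set ts) a (fst s))" if "s \<in> D \<times> X" for a s
    using that by (induction a) auto
  have eu: "exp_util (D \<times> X) ?\<pi> ?\<rho> u (pmf_of_set (D \<times> {x})) a
      = score ts Th (\<lambda>d y. u ((d, x), y)) a / card D" if "x \<in> X" for u a x
  proof -
    have "exp_util (D \<times> X) ?\<pi> ?\<rho> u (pmf_of_set (D \<times> {x})) a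
        = (\<Sum>s\<in>D \<times> X. u (s, atom_fun (set ts) a (fst s)) * pmf (pmf_of_set (D \<times> {x})) s)"
      unfolding exp_util_def by (intro sum.cong) (simp_all only: ci)
    also have "\<dots> = (\<Sum>s\<in>D \<times> {x}. u (s, atom_fun (set ts) a (fst s)) * pmf (pmf_of_set (D \<times> {x})) s)"
      using D X that by (intro sum.mono_neutral_right) (auto simp: pmf_of_set[OF DX(2,1)])
    also have "\<dots> = (\<Sum>s\<in>D \<times> {x}. u (s, atom_fun (set ts) a (fst s)) / card D)"
      by (intro sum.cong) (auto simp: pmf_of_set[OF DX(2,1)] card_cartesian_product)
    also have "\<dots> = score ts Th (\<lambda>d y. u ((d, x), y)) a / card D"
      unfolding score_def D_def[symmetric] sum_divide_distrib sum.cartesian_product'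
      by simp
    finally show ?thesis .
  qed
  have dec: "entails (set ts) d (Neg t) \<longleftrightarrow> \<not> entails (set ts) d t"
    if "d \<in> D" "t \<in> tests (set ts)" for d t
    using that consistent_atom_not_both[of d ts Th t] atom_decides[of d ts t]
    by (auto simp: D_def consistent_atoms_def)
  have and_iff: "entails (set ts) d (And t t') \<longleftrightarrow> entails (set ts) d t \<and> entails (set ts) d t'"
    if "t \<in> tests (set ts)" "t' \<in> tests (set ts)" for d t t'
    using that unfolding entails_def test_interp_def by blast
  have "test_interp (set ts) (D \<times> X) ?\<pi>"
    unfolding test_interp_def by (auto simp: dec and_iff)
  moreover have "respects_theory Th (D \<times> X) ?\<pi>"
    unfolding respects_theory_def using consistent_atom_theory[OF _ _ Th] by (auto simp: D_def)
  moreover have "(a, b) \<in> R \<longleftrightarrow> (\<forall>(u, p)\<in>U \<times> P. exp_util (D \<times> X) ?\<pi> ?\<rho> u p a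
      \<ge> exp_util (D \<times> X) ?\<pi> ?\<rho> u p b)" if "a \<in> C" "b \<in> C" for a b
    using D by (auto simp: R[OF that] P_def eu divide_le_cancel card_gt_0_iff)
  moreover have "\<forall>p\<in>P. set_pmf p \<subseteq> D \<times> X"
    by (auto simp: P_def set_pmf_of_set[OF DX(2,1)])
  ultimately show ?thesis
    using D X A0 unfolding SEU_rep_def by auto
qed

lemma map_prod_image_Times: "map_prod f g ` (A \<times> B) = f ` A \<times> g ` B"
  by auto

text \<open>One copy of the atoms suffices when the utility may vary. The set of pairs is kept
  explicit so that a single score yields a single pair of utility and distribution.\<close>

lemma SEU_rep_scores:
  fixes W :: "('p test \<Rightarrow> 'a \<Rightarrow> real) set"
  assumes A0: "finite A0" and Th: "Th \<subseteq> tests (set ts)" and con: "consistent ts Th"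
    and C: "C \<subseteq> choices A0 (set ts)"
    and R: "\<And>a b. a \<in> C \<Longrightarrow> b \<in> C \<Longrightarrow>
      (a, b) \<in> R \<longleftrightarrow> (\<forall>w\<in>W. score ts Th w a \<ge> score ts Th w b)"
  shows "\<exists>(S::nat set) (Out::nat set) f p \<pi> \<rho>.
    SEU_rep (set ts) A0 Th C R S Out (f ` W) {p} (f ` W \<times> {p}) \<pi> \<rho>"
proof -
  let ?D = "consistent_atoms ts Th"
  define e :: "('p test \<Rightarrow> 'a \<Rightarrow> real) \<Rightarrow> ('p test \<times> unit) \<times> 'a \<Rightarrow> real"
    where "e w = (\<lambda>((d, _), a). w d a)" for w
  have "finite (?D \<times> {()})" "finite ((?D \<times> {()}) \<times> A0)"
    using A0 finite_consistent_atoms by blast+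
  then obtain g h :: "_ \<Rightarrow> nat" where g: "inj_on g (?D \<times> {()})" and h: "inj_on h ((?D \<times> {()}) \<times> A0)"
    by (metis finite_imp_inj_to_nat_seg)
  have "SEU_rep (set ts) A0 Th C R (?D \<times> {()}) ((?D \<times> {()}) \<times> A0) (e ` W)
      ((\<lambda>x. pmf_of_set (?D \<times> {x})) ` {()}) (e ` W \<times> (\<lambda>x. pmf_of_set (?D \<times> {x})) ` {()})
      (\<lambda>t. {s \<in> ?D \<times> {()}. entails (set ts) (fst s) t}) (\<lambda>a s. (s, a))"
    by (rule SEU_rep_product[OF A0 Th con]) (simp_all add: R e_def)
  note tr = SEU_rep_transport[OF this C Th g h]
  show ?thesis
    using tr unfolding map_prod_image_Times image_comp image_insert image_empty by blast
qed

section \<open>Assembling the representations from scores\<close>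

theorem theorem2:
  fixes T0 :: "'p set" and ts :: "'p list" and A0 :: "'a set" and Th :: "'p test set"
    and C :: "('p, 'a) choice set" and R :: "('p, 'a) choice rel"
  assumes "finite T0" and "set ts = T0" and "distinct ts"
    and "finite A0" and "A0 \<noteq> {}"
    and "Th \<subseteq> tests T0" and "consistent ts Th"
    and "C \<subseteq> choices A0 T0"
    and "R \<subseteq> C \<times> C"
  shows "(has_SEU_rep T0 A0 Th C R \<longleftrightarrow> A2' ts Th C R) \<and>
    (A2' ts Th C R \<longrightarrow>
      (\<exists>(S::nat set) (Out::nat set) U p V \<pi> \<rho>. SEU_rep T0 A0 Th C R S Out U {p} V \<pi> \<rho>) \<and>
      (\<exists>(S::nat set) (Out::nat set) u P V \<pi> \<rho>. SEU_rep T0 A0 Th C R S Out {u} P V \<pi> \<rho>) \<and>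
      (\<exists>(Out::nat set) u P V \<pi> \<rho>.
         SEU_rep T0 A0 Th C R (consistent_atoms ts Th \<times> extensions ts Th C R) Out {u} P V \<pi> \<rho>) \<and>
      (A1 C R \<longrightarrow>
        (\<exists>(S::nat set) (Out::nat set) u p \<pi> \<rho>.
           SEU_rep T0 A0 Th C R S Out {u} {p} {(u, p)} \<pi> \<rho>)))"
proof -
  note T0 = assms(2)[symmetric]
  have Th: "Th \<subseteq> tests (set ts)" and C: "C \<subseteq> choices A0 (set ts)" using assms by auto
  have ts: "ts \<noteq> []" using \<open>consistent ts Th\<close> by (auto simp: consistent_def consistent_atoms_def)
  let ?E = "extensions ts Th C R"
  have A2': "A2' ts Th C R" if rep: "has_SEU_rep T0 A0 Th C R"
  proof -
    obtain S Out :: "nat set" and U P V \<pi> \<rho> where "SEU_rep (set ts) A0 Th C R S Out U P V \<pi> \<rho>"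
      using rep unfolding has_SEU_rep_def T0 by blast
    then obtain W :: "('p test \<Rightarrow> 'a \<Rightarrow> real) set" where W: "\<forall>a\<in>C. \<forall>b\<in>C.
        (a, b) \<in> R \<longleftrightarrow> (\<forall>w\<in>W. score ts Th w a \<ge> score ts Th w b)"
      using scores_if_SEU_rep[OF _ C ts] by meson
    show ?thesis by (rule A2'_if_scores[OF bspec[OF bspec[OF W]]])
  qed
  have uniform: "\<exists>(S::nat set) (Out::nat set) U p V \<pi> \<rho>. SEU_rep T0 A0 Th C R S Out U {p} V \<pi> \<rho>"
    if A2': "A2' ts Th C R"
  proof -
    let ?W = "{w :: 'p test \<Rightarrow> 'a \<Rightarrow> real. \<forall>(x, y)\<in>R. score ts Th w x \<ge> score ts Th w y}"
    have "(a, b) \<in> R \<longleftrightarrow> (\<forall>w\<in>?W. score ts Th w a \<ge> score ts Th w b)" if "a \<in> C" "b \<in> C" for a b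
      using A2'_separation[OF A2' assms(4) C assms(9) that] by (fastforce simp: not_le[symmetric])
    from SEU_rep_scores[OF assms(4) Th assms(7) C this] show ?thesis
      unfolding T0 by blast
  qed
  have single: "\<exists>(S::nat set) (Out::nat set) u p \<pi> \<rho>. SEU_rep T0 A0 Th C R S Out {u} {p} {(u, p)} \<pi> \<rho>"
    if A2': "A2' ts Th C R" and A1: "A1 C R"
  proof -
    obtain w :: "'p test \<Rightarrow> 'a \<Rightarrow> real" where "\<forall>a\<in>C. \<forall>b\<in>C.
        (a, b) \<in> R \<longleftrightarrow> score ts Th w a \<ge> score ts Th w b"
      using A1_A2'_score[OF A1 A2' assms(4) C assms(9)] by blast
    then have "(a, b) \<in> R \<longleftrightarrow> (\<forall>w\<in>{w}. score ts Th w a \<ge> score ts Th w b)"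
      if "a \<in> C" "b \<in> C" for a b using that by simp
    from SEU_rep_scores[OF assms(4) Th assms(7) C this] obtain S Out :: "nat set" and f p \<pi> \<rho>
      where "SEU_rep (set ts) A0 Th C R S Out (f ` {w}) {p} (f ` {w} \<times> {p}) \<pi> \<rho>" by blast
    then have "SEU_rep T0 A0 Th C R S Out {f w} {p} {(f w, p)} \<pi> \<rho>"
      by (simp add: T0)
    then show ?thesis by blast
  qed
  have state_space: "\<exists>(Out::nat set) u P V \<pi> \<rho>.
      SEU_rep T0 A0 Th C R (consistent_atoms ts Th \<times> ?E) Out {u} P V \<pi> \<rho>"
    if A2': "A2' ts Th C R"
  proof -
    let ?S = "consistent_atoms ts Th \<times> ?E"
    \<comment> \<open>An extension is complete and satisfies \<open>A2\<close>, hence also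
      \<open>A2'\<close>, so one score represents it.\<close>
    have "\<forall>R'\<in>?E. \<exists>w :: 'p test \<Rightarrow> 'a \<Rightarrow> real. \<forall>a\<in>C. \<forall>b\<in>C.
        (a, b) \<in> R' \<longleftrightarrow> score ts Th w a \<ge> score ts Th w b"
      using A1_A2'_score[OF _ A2'_if_A1_A2 assms(4) C] unfolding extensions_def by blast
    then obtain w :: "_ \<Rightarrow> 'p test \<Rightarrow> 'a \<Rightarrow> real" where w: "\<And>R' a b. R' \<in> ?E \<Longrightarrow> a \<in> C \<Longrightarrow> b \<in> C \<Longrightarrow>
        (a, b) \<in> R' \<longleftrightarrow> score ts Th (w R') a \<ge> score ts Th (w R') b"
      unfolding bchoice_iff by blast
    \<comment> \<open>Since outcomes record the state, one utility can read the extension off the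
      outcome and apply the weights of that extension.\<close>
    define u where "u = (\<lambda>((d, R'), a). w R' d a)"
    have fin: "finite ?E" by (rule finite_extensions[OF assms(4) C])
    have "finite (?S \<times> A0)" using fin assms(4) finite_consistent_atoms by blast
    then obtain h :: "_ \<Rightarrow> nat" where h: "inj_on h (?S \<times> A0)"
      by (metis finite_imp_inj_to_nat_seg)
    have "(a, b) \<in> R \<longleftrightarrow> (\<forall>u\<in>{u}. \<forall>R'\<in>?E. score ts Th (\<lambda>d y. u ((d, R'), y)) a
        \<ge> score ts Th (\<lambda>d y. u ((d, R'), y)) b)" if "a \<in> C" "b \<in> C" for a b
      using A2'_iff_all_extensions[OF A2' assms(4) C assms(9) that] w that by (simp add: u_def)
    \<comment> \<open>The identity on states keeps the required state space; only the outcomes are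
      renamed to naturals.\<close>
    from SEU_rep_transport[OF SEU_rep_product[OF assms(4) Th assms(7) fin this] C Th inj_on_id h]
    show ?thesis unfolding T0 image_id image_insert image_empty id_apply by blast
  qed
  have singleton_utility: "\<exists>(S::nat set) (Out::nat set) u P V \<pi> \<rho>. SEU_rep T0 A0 Th C R S Out {u} P V \<pi> \<rho>"
    if A2': "A2' ts Th C R"
  proof -
    obtain Out :: "nat set" and u P V \<pi> \<rho>
      where rep: "SEU_rep T0 A0 Th C R (consistent_atoms ts Th \<times> ?E) Out {u} P V \<pi> \<rho>"
      using state_space[OF A2'] by blast
    then obtain g :: "_ \<Rightarrow> nat" where "inj_on g (consistent_atoms ts Th \<times> ?E)"
      unfolding SEU_rep_def by (metis finite_imp_inj_to_nat_seg)
    \<comment> \<open>Here the states are renamed and the outcomes kept.\<close>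
    from SEU_rep_transport[OF rep assms(8,6) this inj_on_id] show ?thesis
      unfolding image_insert image_empty by blast
  qed
  have "has_SEU_rep T0 A0 Th C R" if "A2' ts Th C R"
    using uniform[OF that] unfolding has_SEU_rep_def by blast
  with A2' uniform singleton_utility state_space single show ?thesis by blast
qed

end
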